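(* Let $\Gamma=(V,E)$ be a simple connected graph on $n$ vertices and let $\mathbf{G}$ be its combinatorial Green's function. Then for all $u,v\in V$, $$\mathbf{G}(u,v)=\frac{1}{n^2\tau}\Big(\sum_{\substack{T_1 \cup T_2 \in \mathbb{F}_2\\ u,v\in T_1}}|T_2|^2-\sum_{\substack{T_1 \cup T_2 \in \mathbb{F}_2\\ u\in T_1,\ v\in T_2}}|T_1||T_2|\Big),$$ where $\tau$ is the number of (unrooted) spanning trees of $\Gamma$ and $\mathbb{F}_2$ denotes the family of (unrooted) spanning $2$-forests of $\Gamma$.
   Context: $\Gamma$ is a finite undirected simple unweighted graph, with adjacency matrix $A$, diagonal degree matrix $D$, and combinatorial Laplacian $L=D-A$. The combinatorial Green's function $\mathbf{G}$ is the Moore–Penrose pseudoinverse of $L$. A spanning $2$-forest is a subgraph containing all vertices of $\Gamma$, with no cycles and exactly two connected components; it is written $T_1\cup T_2$, where $T_1,T_2$ are its components, and $|T_i|$ is the number of vertices of $T_i$. The order of $T_1$ and $T_2$ is irrelevant: a sum ranges over forests, each counted once, with the components named so that the condition under the sum holds. *)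

theory Defs
  imports "HOL-Analysis.Analysis"
begin

text \<open>
  A graph on the vertex set \<open>V = UNIV :: 'v set\<close>, with \<open>'v\<close> a finite type, is given by its set
  of edges \<open>E :: 'v set set\<close>. A spanning subgraph keeps all vertices, so it is given by a
  subset of \<open>E\<close>; this is how spanning trees and spanning 2-forests are represented.
\<close>

definition simple_graph :: "'v::finite set set \<Rightarrow> bool" where
  "simple_graph E \<longleftrightarrow> (\<forall>e\<in>E. card e = 2)"

definition adjacent :: "'v set set \<Rightarrow> 'v \<Rightarrow> 'v \<Rightarrow> bool" where
  "adjacent E u v \<longleftrightarrow> {u, v} \<in> E"

definition component_of :: "'v set set \<Rightarrow> 'v \<Rightarrow> 'v set" where
  "component_of E u = {v. (adjacent E)\<^sup>*\<^sup>* u v}"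

definition components_of_graph :: "'v set set \<Rightarrow> 'v set set" where
  "components_of_graph E = range (component_of E)"

definition connected_graph :: "'v set set \<Rightarrow> bool" where
  "connected_graph E \<longleftrightarrow> (\<forall>u v. (adjacent E)\<^sup>*\<^sup>* u v)"

text \<open>A cycle is the list of its distinct vertices, the first one not repeated at the end.\<close>

definition graph_cycle :: "'v set set \<Rightarrow> 'v list \<Rightarrow> bool" where
  "graph_cycle E p \<longleftrightarrow>
     length p \<ge> 3 \<and> distinct p \<and> successively (adjacent E) p \<and> adjacent E (last p) (hd p)"

definition acyclic_graph :: "'v set set \<Rightarrow> bool" where
  "acyclic_graph E \<longleftrightarrow> (\<nexists>p. graph_cycle E p)"

definition spanning_trees :: "'v set set \<Rightarrow> 'v set set set" where
  "spanning_trees E = {F. F \<subseteq> E \<and> acyclic_graph F \<and> connected_graph F}"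

definition spanning_2forests :: "'v set set \<Rightarrow> 'v set set set" where
  "spanning_2forests E = {F. F \<subseteq> E \<and> acyclic_graph F \<and> card (components_of_graph F) = 2}"

definition degree :: "'v set set \<Rightarrow> 'v \<Rightarrow> nat" where
  "degree E v = card {e\<in>E. v \<in> e}"

definition adjacency_matrix :: "'v::finite set set \<Rightarrow> real^'v^'v" where
  "adjacency_matrix E = (\<chi> i j. if adjacent E i j then 1 else 0)"

definition degree_matrix :: "'v::finite set set \<Rightarrow> real^'v^'v" where
  "degree_matrix E = (\<chi> i j. if i = j then real (degree E i) else 0)"

definition laplacian :: "'v::finite set set \<Rightarrow> real^'v^'v" where
  "laplacian E = degree_matrix E - adjacency_matrix E"

text \<open>The four Penrose conditions; the conjugate transpose of a real matrix is its transpose.\<close>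

definition is_pseudoinverse :: "real^'n^'m \<Rightarrow> real^'m^'n \<Rightarrow> bool" where
  "is_pseudoinverse A X \<longleftrightarrow>
     A ** X ** A = A \<and> X ** A ** X = X \<and>
     transpose (A ** X) = A ** X \<and> transpose (X ** A) = X ** A"

definition pseudoinverse :: "real^'n^'m \<Rightarrow> real^'m^'n" where
  "pseudoinverse A = (THE X. is_pseudoinverse A X)"

lemma is_pseudoinverse_unique:
  fixes A :: "real^'n^'m"
  assumes X: "is_pseudoinverse A X" and Y: "is_pseudoinverse A Y"
  shows "X = Y"
proof -
  have "A ** X = transpose ((A ** Y) ** (A ** X))"
    using X Y by (metis is_pseudoinverse_def matrix_mul_assoc)
  also have "\<dots> = (A ** X) ** (A ** Y)"
    using X Y by (simp add: matrix_transpose_mul is_pseudoinverse_def)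
  also have "\<dots> = A ** Y"
    using X by (metis is_pseudoinverse_def matrix_mul_assoc)
  finally have AX: "A ** X = A ** Y" .
  have "X ** A = transpose ((X ** A) ** (Y ** A))"
    using X Y by (metis is_pseudoinverse_def matrix_mul_assoc)
  also have "\<dots> = (Y ** A) ** (X ** A)"
    using X Y by (simp add: matrix_transpose_mul is_pseudoinverse_def)
  also have "\<dots> = Y ** A"
    using X by (metis is_pseudoinverse_def matrix_mul_assoc)
  finally have XA: "X ** A = Y ** A" .
  show ?thesis
    using X Y AX XA by (metis is_pseudoinverse_def matrix_mul_assoc)
qed

lemma pseudoinverse_eqI: "is_pseudoinverse A X \<Longrightarrow> pseudoinverse A = X"
  unfolding pseudoinverse_def by (blast intro: is_pseudoinverse_unique)

definition green :: "'v::finite set set \<Rightarrow> real^'v^'v" where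
  "green E = pseudoinverse (laplacian E)"

text \<open>
  \<open>named_2forests E\<close> pairs each spanning 2-forest \<open>F\<close> with the two possible ways of naming its
  components \<open>T1\<close>, \<open>T2\<close> (as vertex sets). Requiring a given vertex to lie in \<open>T1\<close>
  selects exactly one of them, so that every forest is then counted once.
\<close>

definition named_2forests :: "'v set set \<Rightarrow> ('v set set \<times> 'v set \<times> 'v set) set" where
  "named_2forests E =
     {(F, T1, T2). F \<in> spanning_2forests E \<and> components_of_graph F = {T1, T2}}"

end

theory Submission
  imports Defs
begin

text \<open>
  Let \<open>\<tau>\<close> be the number of spanning trees of the graph on \<open>n\<close> vertices. For a spanning 2-forest \<open>F\<close>
  let \<open>C\<^sub>F(x)\<close> be the component of \<open>x\<close>. Its contribution \<open>K\<^sub>F(u, v)\<close> to the difference of the two sums,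
  called \<open>forest_kernel\<close> below, is \<open>f(u) f(v)\<close>, where \<open>f\<close> takes the value \<open>|T2|\<close> on \<open>T1\<close> and \<open>-|T1|\<close>
  on \<open>T2\<close>. So the matrix \<open>X\<close> on the right-hand side is symmetric, and its columns sum to 0
  because \<open>|T1| |T2| - |T2| |T1| = 0\<close>. It remains to prove \<open>L X = I - J/n\<close>, with \<open>J\<close> the all-ones
  matrix: since \<open>L\<close>, \<open>X\<close> and \<open>I - J/n\<close> are symmetric and the columns of \<open>L\<close> and \<open>X\<close> sum to 0, the
  Penrose conditions then follow (\<open>pseudoinverse_symmetricI\<close>, \<open>centering_mult\<close>).

  The entry \<open>(L X)(x, y)\<close> sums \<open>X(x, y) - X(z, y)\<close> over the neighbours \<open>z\<close> of \<open>x\<close>. In this difference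
  only forests \<open>F\<close> with \<open>z \<notin> C\<^sub>F(x)\<close> survive, each with the value \<open>n (n [y \<in> C\<^sub>F(x)] - |C\<^sub>F(x)|)\<close>,
  up to the factor \<open>1/(n\<^sup>2 \<tau>)\<close> (\<open>forest_kernel_diff\<close>). For such a pair \<open>(F, z)\<close> the edge \<open>{x, z}\<close>
  joins the two components of \<open>F\<close> to a spanning tree \<open>T\<close>, and \<open>F\<close> is recovered from \<open>T\<close> by deleting
  that edge. The double sum therefore runs over spanning trees \<open>T\<close> and neighbours \<open>z\<close> of \<open>x\<close> in \<open>T\<close>
  (\<open>sum_forests_eq_sum_trees\<close>).

  Fix \<open>T\<close>. The complements of the sets \<open>C\<^sub>F(x)\<close> are now the branches \<open>B\<^sub>z\<close> of \<open>T\<close> at \<open>x\<close>, which partition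
  the vertices other than \<open>x\<close> (\<open>unique_branch\<close>). Since
  \<open>n [y \<in> C\<^sub>F(x)] - |C\<^sub>F(x)| = |B\<^sub>z| - n [y \<in> B\<^sub>z]\<close>, the sum over \<open>z\<close> is
  \<open>(n - 1) - n [y \<noteq> x] = n [x = y] - 1\<close> (\<open>sum_branches_of_tree\<close>). This is the same for all \<open>\<tau>\<close>
  trees, so \<open>(L X)(x, y) = [x = y] - 1/n\<close>. The division by \<open>\<tau>\<close> is legitimate because a connected
  graph has a spanning tree (\<open>spanning_tree_exists\<close>).
\<close>

section \<open>Reachability under insertion and deletion of an edge\<close>

lemma adjacent_sym: "adjacent F a b \<Longrightarrow> adjacent F b a"
  by (simp add: adjacent_def insert_commute)

lemma component_of_refl [simp]: "a \<in> component_of F a"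
  by (simp add: component_of_def)

lemma component_of_sym: "b \<in> component_of F a \<Longrightarrow> a \<in> component_of F b"
proof -
  have "symp (adjacent F)"
    by (auto intro: sympI adjacent_sym)
  then show "b \<in> component_of F a \<Longrightarrow> a \<in> component_of F b"
    by (auto simp: component_of_def dest: sympD[OF symp_rtranclp])
qed

lemma component_of_trans:
  "b \<in> component_of F a \<Longrightarrow> c \<in> component_of F b \<Longrightarrow> c \<in> component_of F a"
  by (auto simp: component_of_def)

lemma component_of_eq_iff: "component_of F a = component_of F b \<longleftrightarrow> b \<in> component_of F a"
proof
  assume "component_of F a = component_of F b"
  then show "b \<in> component_of F a"
    by simp
next
  assume b: "b \<in> component_of F a"
  show "component_of F a = component_of F b"
    using component_of_trans[OF b] component_of_trans[OF component_of_sym[OF b]] by blast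
qed

lemma component_of_edge: "{a, b} \<in> F \<Longrightarrow> b \<in> component_of F a"
  by (auto simp: component_of_def adjacent_def)

lemma component_of_mono: "F \<subseteq> F' \<Longrightarrow> component_of F a \<subseteq> component_of F' a"
  unfolding component_of_def
  by (auto elim!: rtranclp_mono[THEN predicate2D, rotated] simp: adjacent_def)

lemma connected_graph_iff: "connected_graph F \<longleftrightarrow> (\<forall>a b. b \<in> component_of F a)"
  by (simp add: connected_graph_def component_of_def)

text \<open>
  Every edge-by-edge argument below rests on this dichotomy: a walk in the enlarged graph either
  avoids the new edge, or it can be shortened so as to cross it once, in one of the two directions.
\<close>

lemma component_of_insert_edge:
  assumes "y \<in> component_of (insert {a, b} F) x"
  shows "y \<in> component_of F x \<or> (a \<in> component_of F x \<and> y \<in> component_of F b)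
    \<or> (b \<in> component_of F x \<and> y \<in> component_of F a)"
proof -
  have "(adjacent (insert {a, b} F))\<^sup>*\<^sup>* x y"
    using assms by (simp add: component_of_def)
  then show ?thesis
  proof (induction rule: rtranclp_induct)
    case base
    then show ?case by simp
  next
    case (step y z)
    show ?case
    proof (cases "{y, z} \<in> F")
      case True
      then show ?thesis
        using step.IH component_of_edge component_of_trans by metis
    next
      case False
      then have "y = a \<and> z = b \<or> y = b \<and> z = a"
        using step.hyps(2) by (auto simp: adjacent_def doubleton_eq_iff)
      then show ?thesis
        using step.IH by auto
    qed
  qed
qed

section \<open>Acyclicity as the absence of redundant edges\<close>

text \<open>
  Loops are cut off while the path is extended at its front: if the new vertex \<open>a\<close> already occurs,
  the part of the path before it is dropped.
\<close>

lemma component_of_imp_path: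
  assumes "b \<in> component_of F a"
  obtains p where "p \<noteq> []" "hd p = a" "last p = b" "distinct p" "successively (adjacent F) p"
proof -
  have "(adjacent F)\<^sup>*\<^sup>* a b"
    using assms by (simp add: component_of_def)
  then have "\<exists>p. p \<noteq> [] \<and> hd p = a \<and> last p = b \<and> distinct p \<and> successively (adjacent F) p"
  proof (induction rule: converse_rtranclp_induct)
    case base
    show ?case by (rule exI[of _ "[b]"]) simp
  next
    case (step a c)
    then obtain p where p: "p \<noteq> []" "hd p = c" "last p = b" "distinct p"
      "successively (adjacent F) p" by blast
    show ?case
    proof (cases "a \<in> set p")
      case True
      then obtain ys zs where "p = ys @ a # zs" by (meson split_list)
      then show ?thesis
        using p by (intro exI[of _ "a # zs"]) (auto simp: successively_append_iff)
    next
      case False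
      then show ?thesis
        using p step.hyps(1)
        by (intro exI[of _ "a # p"]) (auto simp: successively_Cons)
    qed
  qed
  then show ?thesis using that by blast
qed

lemma successively_imp_component_of:
  "successively (adjacent F) p \<Longrightarrow> p \<noteq> [] \<Longrightarrow> last p \<in> component_of F (hd p)"
proof (induction p rule: induct_list012)
  case (3 a b p)
  then have "{a, b} \<in> F" "last (b # p) \<in> component_of F b"
    by (auto simp: adjacent_def)
  then show ?case
    using component_of_trans[OF component_of_edge] by fastforce
qed auto

text \<open>
  This replaces lists of vertices by reachability. A cycle consists of an edge \<open>{a, b}\<close> and a path
  from \<open>a\<close> to \<open>b\<close> that does not use that edge. Conversely, such a path has at least three vertices,
  as \<open>a \<noteq> b\<close> and the direct step is excluded, so the edge closes it to a cycle.
\<close>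

lemma acyclic_iff_edges_not_redundant:
  assumes "simple_graph F"
  shows "acyclic_graph F \<longleftrightarrow> (\<forall>a b. {a, b} \<in> F \<longrightarrow> b \<notin> component_of (F - {{a, b}}) a)"
    (is "_ \<longleftrightarrow> ?R")
proof
  assume ac: "acyclic_graph F"
  show ?R
  proof (intro allI impI notI)
    fix a b assume ab: "{a, b} \<in> F" and conn: "b \<in> component_of (F - {{a, b}}) a"
    have "a \<noteq> b"
      using assms ab by (auto simp: simple_graph_def)
    obtain p where p: "p \<noteq> []" "hd p = a" "last p = b" "distinct p"
      "successively (adjacent (F - {{a, b}})) p"
      using conn by (rule component_of_imp_path)
    have "length p \<noteq> 1"
      using p \<open>a \<noteq> b\<close> by (auto simp: length_Suc_conv)
    moreover have "length p \<noteq> 2"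
      using p by (auto simp: length_Suc_conv numeral_2_eq_2 adjacent_def)
    moreover have "length p \<noteq> 0"
      using p by simp
    ultimately have "length p \<ge> 3"
      by linarith
    moreover have "successively (adjacent F) p"
      using p(5) by (rule successively_mono) (auto simp: adjacent_def)
    moreover have "adjacent F (last p) (hd p)"
      using ab p by (simp add: adjacent_def insert_commute)
    ultimately have "graph_cycle F p"
      using p by (simp add: graph_cycle_def)
    then show False
      using ac by (auto simp: acyclic_graph_def)
  qed
next
  assume R: ?R
  show "acyclic_graph F"
    unfolding acyclic_graph_def
  proof
    assume "\<exists>p. graph_cycle F p"
    then obtain p where p: "length p \<ge> 3" "distinct p" "successively (adjacent F) p"
      "adjacent F (last p) (hd p)" by (auto simp: graph_cycle_def)
    let ?e = "{hd p, last p}"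
    have "successively (adjacent (F - {?e})) p"
      unfolding successively_conv_nth
    proof (intro allI impI)
      fix i assume i: "Suc i < length p"
      then have "p \<noteq> []"
        by auto
      then have h: "hd p = p ! 0" "last p = p ! (length p - 1)"
        by (auto simp: hd_conv_nth last_conv_nth)
      \<comment> \<open>The closing edge joins positions \<open>0\<close> and \<open>length p - 1\<close>, which are not consecutive.\<close>
      have ne: "{p ! i, p ! Suc i} \<noteq> ?e"
      proof
        assume "{p ! i, p ! Suc i} = ?e"
        then have "(p ! i = p ! 0 \<and> p ! Suc i = p ! (length p - 1)) \<or>
            (p ! i = p ! (length p - 1) \<and> p ! Suc i = p ! 0)"
          unfolding h by (auto simp: doubleton_eq_iff)
        then show False
        proof (elim disjE conjE)
          assume "p ! i = p ! 0" "p ! Suc i = p ! (length p - 1)"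
          then have "i = 0" "Suc i = length p - 1"
            using i \<open>p \<noteq> []\<close> p(2) by (simp_all add: nth_eq_iff_index_eq)
          then show False
            using p(1) by simp
        next
          assume "p ! Suc i = p ! 0"
          then show False
            using i \<open>p \<noteq> []\<close> p(2) by (simp add: nth_eq_iff_index_eq)
        qed
      qed
      have "adjacent F (p ! i) (p ! Suc i)"
        using p(3) i by (simp add: successively_conv_nth)
      then show "adjacent (F - {?e}) (p ! i) (p ! Suc i)"
        using ne by (simp add: adjacent_def)
    qed
    then have "last p \<in> component_of (F - {?e}) (hd p)"
      using p(1) by (intro successively_imp_component_of) auto
    moreover have "?e \<in> F"
      using p(4) by (simp add: adjacent_def insert_commute)
    ultimately show False
      using R by blast
  qed
qed

lemma acyclic_subset: "acyclic_graph F \<Longrightarrow> F' \<subseteq> F \<Longrightarrow> acyclic_graph F'"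
  unfolding acyclic_graph_def graph_cycle_def
  by (metis (no_types, lifting) adjacent_def subsetD successively_mono)

lemma simple_graph_subset: "simple_graph E \<Longrightarrow> F \<subseteq> E \<Longrightarrow> simple_graph F"
  by (auto simp: simple_graph_def)

section \<open>Trees and two-component forests\<close>

text \<open>
  If an old edge \<open>{c, d}\<close> became redundant, the detour around it would cross the new edge \<open>{a, b}\<close>;
  its two halves together with \<open>{c, d}\<close> would connect \<open>a\<close> and \<open>b\<close> in \<open>F\<close>.
\<close>

lemma acyclic_insert_edge:
  assumes "simple_graph F" "acyclic_graph F" "b \<notin> component_of F a"
  shows "acyclic_graph (insert {a, b} F)"
proof -
  have "a \<noteq> b"
    using assms(3) by auto
  then have simp_ins: "simple_graph (insert {a, b} F)"
    using assms(1) by (simp add: simple_graph_def)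
  have new: "{a, b} \<notin> F"
    using assms(3) component_of_edge by metis
  show ?thesis
    unfolding acyclic_iff_edges_not_redundant[OF simp_ins]
  proof (intro allI impI notI)
    fix c d
    assume cd: "{c, d} \<in> insert {a, b} F"
      and conn: "d \<in> component_of (insert {a, b} F - {{c, d}}) c"
    show False
    proof (cases "{c, d} = {a, b}")
      case True
      then have "d \<in> component_of F c"
        using conn new by simp
      then show False
        using True assms(3) component_of_sym by (metis doubleton_eq_iff)
    next
      case False
      let ?F = "F - {{c, d}}"
      have cdF: "{c, d} \<in> F"
        using cd False by auto
      have "insert {a, b} F - {{c, d}} = insert {a, b} ?F"
        using False by auto
      then have "d \<in> component_of ?F c \<or> (a \<in> component_of ?F c \<and> d \<in> component_of ?F b)
          \<or> (b \<in> component_of ?F c \<and> d \<in> component_of ?F a)"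
        using conn component_of_insert_edge by metis
      moreover have "d \<notin> component_of ?F c"
        using assms(1,2) cdF by (simp add: acyclic_iff_edges_not_redundant)
      ultimately have "(a \<in> component_of F c \<and> d \<in> component_of F b)
          \<or> (b \<in> component_of F c \<and> d \<in> component_of F a)"
        using component_of_mono[of ?F F] by blast
      moreover have "d \<in> component_of F c"
        using cdF by (rule component_of_edge)
      ultimately show False
        using assms(3) by (metis component_of_sym component_of_trans)
    qed
  qed
qed

lemma components_of_2forest:
  assumes "card (components_of_graph F) = 2" "b \<notin> component_of F a"
  shows "components_of_graph F = {component_of F a, component_of F b}"
proof -
  have "{component_of F a, component_of F b} \<subseteq> components_of_graph F"
    by (auto simp: components_of_graph_def)
  moreover have "card {component_of F a, component_of F b} = 2"
    using assms(2) component_of_eq_iff[of F a b] by simp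
  moreover have "finite (components_of_graph F)"
    using assms(1) by (metis card.infinite zero_neq_numeral)
  ultimately show ?thesis
    using assms(1) by (metis card_subset_eq)
qed

lemma component_of_other_in_2forest:
  fixes F :: "'v::finite set set"
  assumes "card (components_of_graph F) = 2" "b \<notin> component_of F a"
  shows "component_of F b = - component_of F a"
proof -
  have "y \<in> component_of F a \<or> y \<in> component_of F b" for y
  proof -
    have "component_of F y \<in> components_of_graph F"
      by (simp add: components_of_graph_def)
    then show ?thesis
      using components_of_2forest[OF assms] by (metis component_of_refl insertE singletonD)
  qed
  moreover have "\<not> (y \<in> component_of F a \<and> y \<in> component_of F b)" for y
    using assms(2) component_of_sym component_of_trans by metis
  ultimately show ?thesis
    by blast
qed

text \<open>
  Together with \<open>delete_edge_spanning_tree\<close> this gives, for a fixed vertex \<open>a\<close>, the bijection between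
  pairs of a 2-forest and an edge at \<open>a\<close> joining its components and pairs of a tree and one of its
  edges at \<open>a\<close>.
\<close>

lemma insert_edge_2forest_spanning_tree:
  assumes E: "simple_graph E" and F: "F \<in> spanning_2forests E"
    and ab: "{a, b} \<in> E" "b \<notin> component_of F a"
  shows "insert {a, b} F \<in> spanning_trees E"
proof -
  let ?T = "insert {a, b} F"
  have F': "F \<subseteq> E" "acyclic_graph F" "card (components_of_graph F) = 2"
    using F by (auto simp: spanning_2forests_def)
  have "y \<in> component_of ?T a" for y
  proof (cases "y \<in> component_of F a")
    case True
    then show ?thesis
      using component_of_mono[of F ?T] by blast
  next
    case False
    then have "y \<in> component_of F b"
      using component_of_other_in_2forest[OF F'(3) ab(2)] by blast
    then have "y \<in> component_of ?T b"
      using component_of_mono[of F ?T] by blast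
    then show ?thesis
      using component_of_edge[of a b ?T] by (auto intro: component_of_trans)
  qed
  then have "connected_graph ?T"
    unfolding connected_graph_iff using component_of_sym component_of_trans by metis
  then show ?thesis
    using F' ab acyclic_insert_edge[OF simple_graph_subset[OF E F'(1)]]
    by (simp add: spanning_trees_def)
qed

lemma delete_edge_spanning_tree:
  assumes E: "simple_graph E" and T: "T \<in> spanning_trees E" and ab: "{a, b} \<in> T"
  shows "T - {{a, b}} \<in> spanning_2forests E" "b \<notin> component_of (T - {{a, b}}) a"
proof -
  let ?F = "T - {{a, b}}"
  have T': "T \<subseteq> E" "acyclic_graph T" "connected_graph T"
    using T by (auto simp: spanning_trees_def)
  show sep: "b \<notin> component_of ?F a"
    using ab T'(2) simple_graph_subset[OF E T'(1)] by (simp add: acyclic_iff_edges_not_redundant)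
  have "y \<in> component_of ?F a \<or> y \<in> component_of ?F b" for y
  proof -
    have "y \<in> component_of (insert {a, b} ?F) a"
      using ab T'(3) by (simp add: connected_graph_iff insert_absorb)
    then show ?thesis
      using component_of_insert_edge by metis
  qed
  then have "components_of_graph ?F = {component_of ?F a, component_of ?F b}"
    unfolding components_of_graph_def using component_of_eq_iff[of ?F a] component_of_eq_iff[of ?F b]
    by blast
  moreover have "component_of ?F a \<noteq> component_of ?F b"
    using sep by (simp add: component_of_eq_iff)
  ultimately have "card (components_of_graph ?F) = 2"
    by simp
  then show "?F \<in> spanning_2forests E"
    using T' acyclic_subset[OF T'(2)] by (auto simp: spanning_2forests_def)
qed

text \<open>
  A minimal connected spanning subgraph is a tree, since a redundant edge could be removed without
  losing connectedness.
\<close>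

lemma spanning_tree_exists:
  fixes E :: "'v::finite set set"
  assumes E: "simple_graph E" "connected_graph E"
  shows "spanning_trees E \<noteq> {}"
proof -
  let ?S = "{F. F \<subseteq> E \<and> connected_graph F}"
  have "finite ?S" "E \<in> ?S"
    using E by auto
  then obtain F where F: "F \<in> ?S" and min: "\<And>F'. F' \<in> ?S \<Longrightarrow> F' \<subseteq> F \<Longrightarrow> F' = F"
    using finite_has_minimal2[of ?S E] by (metis (no_types, lifting))
  have "b \<notin> component_of (F - {{a, b}}) a" if ab: "{a, b} \<in> F" for a b
  proof
    let ?F = "F - {{a, b}}"
    assume conn: "b \<in> component_of ?F a"
    have "y \<in> component_of ?F x" for x y
    proof -
      have "y \<in> component_of (insert {a, b} ?F) x"
        using ab F by (simp add: connected_graph_iff insert_absorb)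
      from component_of_insert_edge[OF this] show ?thesis
        using conn component_of_sym component_of_trans by metis
    qed
    then have "?F = F"
      using F by (intro min) (auto simp: connected_graph_iff)
    then show False
      using ab by blast
  qed
  then have "acyclic_graph F"
    using F simple_graph_subset[OF E(1)] by (auto simp: acyclic_iff_edges_not_redundant)
  then show ?thesis
    using F by (auto simp: spanning_trees_def)
qed

section \<open>The branches of a tree at a vertex\<close>

text \<open>
  Cutting a walk from \<open>x\<close> to \<open>y\<close> after its last visit to \<open>x\<close> leaves an edge \<open>{x, z}\<close> followed by a walk
  that avoids \<open>x\<close>. The avoidance of the whole vertex makes the second part survive the deletion of
  any edge at \<open>x\<close>.
\<close>

lemma component_of_first_edge:
  assumes "y \<in> component_of T x"
  shows "y = x \<or> (\<exists>z. {x, z} \<in> T \<and> y \<in> component_of {e \<in> T. x \<notin> e} z)"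
proof -
  have "(adjacent T)\<^sup>*\<^sup>* x y"
    using assms by (simp add: component_of_def)
  then show ?thesis
  proof (induction rule: rtranclp_induct)
    case (step y w)
    show ?case
    proof (cases "w = x \<or> y = x")
      case True
      then show ?thesis
        using step.hyps(2) by (auto simp: adjacent_def)
    next
      case False
      then obtain z where "{x, z} \<in> T" "y \<in> component_of {e \<in> T. x \<notin> e} z"
        using step.IH by blast
      moreover have "w \<in> component_of {e \<in> T. x \<notin> e} y"
        using step.hyps(2) False by (intro component_of_edge) (auto simp: adjacent_def)
      ultimately show ?thesis
        using component_of_trans[of y "{e \<in> T. x \<notin> e}" z w] by blast
    qed
  qed simp
qed

text \<open>
  The branch is the one entered by the edge \<open>{x, z}\<close> through which \<open>y\<close> is reached without returning
  to \<open>x\<close>. Deleting any other edge at \<open>x\<close> keeps that connection intact, so it does not separate \<open>y\<close>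
  from \<open>x\<close>.
\<close>

lemma unique_branch:
  assumes E: "simple_graph E" and T: "T \<in> spanning_trees E" and xy: "y \<noteq> x"
  shows "\<exists>!z. {x, z} \<in> T \<and> y \<notin> component_of (T - {{x, z}}) x"
proof -
  have "y \<in> component_of T x"
    using T by (simp add: spanning_trees_def connected_graph_iff)
  then obtain z where z: "{x, z} \<in> T" "y \<in> component_of {e \<in> T. x \<notin> e} z"
    using component_of_first_edge xy by metis
  have reach: "y \<in> component_of (T - {{x, w}}) z" for w
    using z(2) component_of_mono[of "{e \<in> T. x \<notin> e}" "T - {{x, w}}" z] by auto
  show ?thesis
  proof (intro ex1I conjI)
    show "{x, z} \<in> T" by (rule z)
    show "y \<notin> component_of (T - {{x, z}}) x"
      using delete_edge_spanning_tree(2)[OF E T z(1)] reach[of z] component_of_sym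
        component_of_trans by metis
  next
    fix w assume w: "{x, w} \<in> T \<and> y \<notin> component_of (T - {{x, w}}) x"
    show "w = z"
    proof (rule ccontr)
      assume "w \<noteq> z"
      then have "{x, z} \<in> T - {{x, w}}"
        using z(1) by (auto simp: doubleton_eq_iff)
      then show False
        using w reach[of w] component_of_edge component_of_trans by metis
    qed
  qed
qed

lemma real_card_Compl: "real (card (- S)) = real CARD('v) - real (card S)"
  for S :: "'v::finite set"
  by (simp add: Compl_eq_Diff_UNIV card_Diff_subset of_nat_diff card_mono)

text \<open>
  The set \<open>component_of (T - {{x, z}}) x\<close> is the complement of the branch at \<open>z\<close>. Both the cardinalities
  and the indicators are therefore written in terms of the indicator \<open>far\<close> of the branches, which
  sums to 1 over \<open>z\<close> at every vertex other than \<open>x\<close> and to 0 at \<open>x\<close>.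
\<close>

lemma sum_branches_of_tree:
  fixes E :: "'v::finite set set"
  assumes E: "simple_graph E" and T: "T \<in> spanning_trees E"
  shows "(\<Sum>z | {x, z} \<in> T. (if y \<in> component_of (T - {{x, z}}) x then real CARD('v) else 0)
            - real (card (component_of (T - {{x, z}}) x)))
       = (if x = y then real CARD('v) else 0) - 1"
proof -
  let ?C = "\<lambda>z. component_of (T - {{x, z}}) x"
  let ?far = "\<lambda>z y. if y \<notin> ?C z then 1 else (0::real)"
  let ?n = "real CARD('v)"
  have far: "(\<Sum>z | {x, z} \<in> T. ?far z y) = (if y = x then 0 else 1)" for y
  proof (cases "y = x")
    case True
    then show ?thesis by simp
  next
    case False
    then obtain w where "{z. {x, z} \<in> T \<and> y \<notin> ?C z} = {w}"
      using unique_branch[OF E T False] by auto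
    then show ?thesis
      using False by (simp add: sum.If_cases Collect_conj_eq[symmetric])
  qed
  have card_C: "real (card (?C z)) = ?n - (\<Sum>y\<in>UNIV. ?far z y)" for z
  proof -
    have "(\<Sum>y\<in>UNIV. ?far z y) = real (card (- ?C z))"
      by (simp add: sum.If_cases Compl_eq)
    also have "\<dots> = ?n - real (card (?C z))"
      by (simp add: real_card_Compl)
    finally show ?thesis by simp
  qed
  have "(\<Sum>z | {x, z} \<in> T. (if y \<in> ?C z then ?n else 0) - real (card (?C z)))
      = (\<Sum>z | {x, z} \<in> T. (\<Sum>y\<in>UNIV. ?far z y) - ?n * ?far z y)"
    by (intro sum.cong) (auto simp: card_C)
  also have "\<dots> = (\<Sum>y\<in>UNIV. \<Sum>z | {x, z} \<in> T. ?far z y) - ?n * (\<Sum>z | {x, z} \<in> T. ?far z y)"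
    unfolding sum_subtractf sum_distrib_left by (subst sum.swap) simp
  also have "\<dots> = (\<Sum>y\<in>UNIV. if y = x then 0 else 1) - ?n * (if y = x then 0 else 1)"
    by (simp only: far)
  also have "(\<Sum>y\<in>UNIV. if y = x then 0 else (1::real)) = ?n - 1"
    by (simp add: sum.If_cases Collect_neg_eq real_card_Compl)
  finally show ?thesis by auto
qed

lemma sum_forests_eq_sum_trees:
  fixes E :: "'v::finite set set" and h :: "'v set \<Rightarrow> real"
  assumes E: "simple_graph E"
  shows "(\<Sum>F\<in>spanning_2forests E. \<Sum>z | {x, z} \<in> E \<and> z \<notin> component_of F x.
            h (component_of F x))
       = (\<Sum>T\<in>spanning_trees E. \<Sum>z | {x, z} \<in> T. h (component_of (T - {{x, z}}) x))"
proof -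
  let ?A = "SIGMA F:spanning_2forests E. {z. {x, z} \<in> E \<and> z \<notin> component_of F x}"
  let ?B = "SIGMA T:spanning_trees E. {z. {x, z} \<in> T}"
  have new: "{x, z} \<notin> F" if "z \<notin> component_of F x" for F z
    using that component_of_edge by metis
  have "(\<Sum>(F, z)\<in>?A. h (component_of F x)) =
      (\<Sum>(T, z)\<in>?B. h (component_of (T - {{x, z}}) x))"
  proof (rule sum.reindex_bij_witness[where
        i = "\<lambda>(T, z). (T - {{x, z}}, z)" and j = "\<lambda>(F, z). (insert {x, z} F, z)"])
    show "(case a of (T, z) \<Rightarrow> (T - {{x, z}}, z)) \<in> ?A" if "a \<in> ?B" for a
      using that delete_edge_spanning_tree[OF E] by (auto simp: spanning_trees_def)
    show "(case a of (F, z) \<Rightarrow> (insert {x, z} F, z)) \<in> ?B" if "a \<in> ?A" for a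
      using that insert_edge_2forest_spanning_tree[OF E] by auto
  qed (auto simp: new)
  then show ?thesis
    by (simp only: sum.Sigma finite ball_triv simp_thms)
qed

section \<open>The forest kernel\<close>

text \<open>
  The first case is the square of the size of the component that does not contain \<open>u\<close> and \<open>v\<close>;
  expressing it through \<open>component_of F u\<close> avoids choosing a vertex in that component.
\<close>

definition forest_kernel :: "'v::finite set set \<Rightarrow> 'v \<Rightarrow> 'v \<Rightarrow> real" where
  "forest_kernel F u v =
     (if v \<in> component_of F u then (real CARD('v) - real (card (component_of F u)))\<^sup>2
      else - (real (card (component_of F u)) * real (card (component_of F v))))"

lemma forest_kernel_commute: "forest_kernel F u v = forest_kernel F v u"
  using component_of_eq_iff[of F u v] component_of_sym[of v F u] component_of_sym[of u F v]
  by (auto simp: forest_kernel_def)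

lemma card_component_of_other:
  fixes F :: "'v::finite set set"
  assumes "card (components_of_graph F) = 2" "b \<notin> component_of F a"
  shows "real (card (component_of F b)) = real CARD('v) - real (card (component_of F a))"
  using component_of_other_in_2forest[OF assms] by (simp add: real_card_Compl)

lemma sum_forest_kernel:
  fixes F :: "'v::finite set set"
  assumes "card (components_of_graph F) = 2"
  shows "(\<Sum>v\<in>UNIV. forest_kernel F u v) = 0"
proof -
  let ?C = "component_of F u" and ?n = "real CARD('v)"
  have "(\<Sum>v\<in>UNIV. forest_kernel F u v) =
      (\<Sum>v\<in>UNIV. if v \<in> ?C then (?n - card ?C)\<^sup>2 else - (card ?C * (?n - card ?C)))"
    using card_component_of_other[OF assms]
    by (intro sum.cong) (auto simp: forest_kernel_def)
  also have "\<dots> = real (card ?C) * (?n - card ?C)\<^sup>2 - real (card (- ?C)) * (card ?C * (?n - card ?C))"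
    by (simp add: sum.If_cases)
  also have "real (card (- ?C)) = ?n - card ?C"
    by (simp add: real_card_Compl)
  finally show ?thesis
    by (simp add: power2_eq_square)
qed

text \<open>
  With \<open>c = |C|\<close> for the component \<open>C\<close> of \<open>x\<close>, the two values at a vertex \<open>z\<close> outside \<open>C\<close> differ by
  \<open>(n - c)\<^sup>2 + c (n - c) = n (n - c)\<close> if \<open>y \<in> C\<close>, and by \<open>- c (n - c) - c\<^sup>2 = - n c\<close> otherwise.
\<close>

lemma forest_kernel_diff:
  fixes F :: "'v::finite set set"
  assumes F: "card (components_of_graph F) = 2"
  shows "forest_kernel F x y - forest_kernel F z y =
    (if z \<in> component_of F x then 0
     else real CARD('v) * ((if y \<in> component_of F x then real CARD('v) else 0)
            - real (card (component_of F x))))"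
proof (cases "z \<in> component_of F x")
  case True
  then have "component_of F z = component_of F x"
    using component_of_eq_iff by metis
  then show ?thesis
    using True by (simp add: forest_kernel_def)
next
  case False
  let ?n = "real CARD('v)" and ?c = "real (card (component_of F x))"
  have cz: "component_of F z = - component_of F x" "real (card (component_of F z)) = ?n - ?c"
    using component_of_other_in_2forest[OF F False] card_component_of_other[OF F False] .
  show ?thesis
  proof (cases "y \<in> component_of F x")
    case True
    then have "component_of F y = component_of F x" "y \<notin> component_of F z"
      using component_of_eq_iff[of F x y] cz(1) by simp_all
    then show ?thesis
      using True False
      by (simp add: forest_kernel_def cz(2) power2_eq_square algebra_simps)
  next
    case y: False
    then have "y \<in> component_of F z"
      using cz(1) by simp
    then show ?thesis
      using y False
      by (simp add: forest_kernel_def cz(2) card_component_of_other[OF F y] power2_eq_square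
          algebra_simps)
  qed
qed

text \<open>
  Requiring \<open>u \<in> T1\<close> determines the naming of the components, so each of the two sums of the formula
  is a sum over 2-forests, and the position of \<open>v\<close> decides to which of them a forest belongs.
\<close>

lemma sum_named_2forests_eq_forest_kernel:
  fixes E :: "'v::finite set set"
  shows "(\<Sum>(F, T1, T2) \<in> {(F, T1, T2). (F, T1, T2) \<in> named_2forests E \<and> u \<in> T1 \<and> v \<in> T1}.
            (real (card T2))\<^sup>2)
       - (\<Sum>(F, T1, T2) \<in> {(F, T1, T2). (F, T1, T2) \<in> named_2forests E \<and> u \<in> T1 \<and> v \<in> T2}.
            real (card T1) * real (card T2))
       = (\<Sum>F\<in>spanning_2forests E. forest_kernel F u v)"
proof -
  let ?N = "\<lambda>F. (F, component_of F u, - component_of F u)"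
  let ?n = "real CARD('v)"
  have named: "(F, T1, T2) \<in> named_2forests E \<and> u \<in> T1 \<longleftrightarrow>
      F \<in> spanning_2forests E \<and> T1 = component_of F u \<and> T2 = - component_of F u" for F T1 T2
  proof (cases "F \<in> spanning_2forests E")
    case True
    then have F: "card (components_of_graph F) = 2"
      by (simp add: spanning_2forests_def)
    obtain w where w: "w \<notin> component_of F u"
    proof -
      have "components_of_graph F \<noteq> {component_of F u}"
        using F by auto
      then have "\<exists>w. component_of F w \<noteq> component_of F u"
        by (auto simp: components_of_graph_def)
      then show ?thesis
        using that component_of_eq_iff by metis
    qed
    have "components_of_graph F = {component_of F u, - component_of F u}"
      using components_of_2forest[OF F w] component_of_other_in_2forest[OF F w] by simp
    then show ?thesis
      using True by (simp add: named_2forests_def doubleton_eq_iff) (metis ComplD component_of_refl)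
  next
    case False
    then show ?thesis
      by (simp add: named_2forests_def)
  qed
  have same: "{(F, T1, T2). (F, T1, T2) \<in> named_2forests E \<and> u \<in> T1 \<and> v \<in> T1}
      = ?N ` {F \<in> spanning_2forests E. v \<in> component_of F u}"
    unfolding conj_assoc[symmetric] named by auto
  have diff: "{(F, T1, T2). (F, T1, T2) \<in> named_2forests E \<and> u \<in> T1 \<and> v \<in> T2}
      = ?N ` {F \<in> spanning_2forests E. v \<notin> component_of F u}"
    unfolding conj_assoc[symmetric] named by auto
  have inj: "inj_on ?N S" for S
    by (auto intro: inj_onI)
  have other: "real (card (- component_of F u)) = ?n - real (card (component_of F u))" for F
    by (simp add: real_card_Compl)
  have "(\<Sum>F\<in>spanning_2forests E. forest_kernel F u v) =
      (\<Sum>F | F \<in> spanning_2forests E \<and> v \<in> component_of F u. forest_kernel F u v)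
    + (\<Sum>F | F \<in> spanning_2forests E \<and> v \<notin> component_of F u. forest_kernel F u v)"
    by (subst sum.union_disjoint[symmetric]) (auto intro: sum.cong)
  also have "(\<Sum>F | F \<in> spanning_2forests E \<and> v \<in> component_of F u. forest_kernel F u v)
      = (\<Sum>F | F \<in> spanning_2forests E \<and> v \<in> component_of F u.
           (real (card (- component_of F u)))\<^sup>2)"
    by (intro sum.cong) (auto simp: forest_kernel_def other)
  also have "(\<Sum>F | F \<in> spanning_2forests E \<and> v \<notin> component_of F u. forest_kernel F u v)
      = - (\<Sum>F | F \<in> spanning_2forests E \<and> v \<notin> component_of F u.
           real (card (component_of F u)) * real (card (- component_of F u)))"
    unfolding sum_negf[symmetric]
    by (intro sum.cong)
      (auto simp: forest_kernel_def spanning_2forests_def other card_component_of_other)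
  finally show ?thesis
    unfolding same diff by (simp add: sum.reindex[OF inj])
qed

section \<open>The Laplacian and its pseudoinverse\<close>

lemma degree_eq_card_neighbours:
  fixes E :: "'v::finite set set"
  assumes "simple_graph E"
  shows "degree E x = card {z. {x, z} \<in> E}"
proof -
  have "bij_betw (\<lambda>z. {x, z}) {z. {x, z} \<in> E} {e \<in> E. x \<in> e}"
  proof (rule bij_betwI')
    fix e assume e: "e \<in> {e \<in> E. x \<in> e}"
    then obtain a b where "e = {a, b}"
      using assms by (auto simp: simple_graph_def card_2_iff)
    then show "\<exists>z\<in>{z. {x, z} \<in> E}. e = {x, z}"
      using e by (auto simp: insert_commute)
  qed (auto simp: doubleton_eq_iff)
  then show ?thesis
    unfolding degree_def by (simp add: bij_betw_same_card)
qed

lemma laplacian_mult: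
  fixes E :: "'v::finite set set" and X :: "real^'m^'v"
  assumes "simple_graph E"
  shows "(laplacian E ** X) $ x $ y = (\<Sum>z | {x, z} \<in> E. X $ x $ y - X $ z $ y)"
proof -
  have "(laplacian E ** X) $ x $ y =
      (\<Sum>z\<in>UNIV. (if x = z then real (degree E x) * X $ z $ y else 0)
        - (if {x, z} \<in> E then X $ z $ y else 0))"
    by (auto simp: laplacian_def degree_matrix_def adjacency_matrix_def matrix_matrix_mult_def
        adjacent_def algebra_simps intro!: sum.cong)
  also have "\<dots> = real (degree E x) * X $ x $ y - (\<Sum>z | {x, z} \<in> E. X $ z $ y)"
    by (simp add: sum_subtractf sum.If_cases)
  finally show ?thesis
    by (simp add: degree_eq_card_neighbours[OF assms] sum_subtractf)
qed

lemma transpose_laplacian: "transpose (laplacian E) = laplacian E"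
  by (simp add: transpose_def laplacian_def degree_matrix_def adjacency_matrix_def vec_eq_iff
      adjacent_def insert_commute)

text \<open>
  Here \<open>P\<close> acts as the orthogonal projection onto the common range of \<open>A\<close> and \<open>X\<close>. By symmetry
  \<open>X ** A\<close> is the transpose of \<open>A ** X\<close>, hence also equal to \<open>P\<close>.
\<close>

lemma pseudoinverse_symmetricI:
  fixes A X :: "real^'n^'n"
  assumes A: "transpose A = A" and X: "transpose X = X" and P: "transpose P = P"
    and AX: "A ** X = P" and PA: "P ** A = A" and PX: "P ** X = X"
  shows "pseudoinverse A = X"
proof (rule pseudoinverse_eqI)
  have XA: "X ** A = P"
    using AX A X P by (metis matrix_transpose_mul)
  have "X ** P = X"
    using PX P X by (metis matrix_transpose_mul)
  then show "is_pseudoinverse A X"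
    using AX XA P PA by (simp add: is_pseudoinverse_def matrix_mul_assoc[symmetric])
      (metis AX PA matrix_mul_assoc)
qed

text \<open>
  The matrix \<open>I - J/n\<close> subtracts from each column its mean, so it fixes the matrices whose columns
  sum to zero, which include the Laplacian and its candidate pseudoinverse.
\<close>

lemma centering_mult:
  fixes M :: "real^'m^'v::finite"
  assumes "\<And>y. (\<Sum>x\<in>UNIV. M $ x $ y) = 0"
  shows "(\<chi> x y. (if x = y then 1 else 0) - 1 / real CARD('v)) ** M = M"
proof -
  have "(\<Sum>z\<in>UNIV. ((if x = z then 1 else 0) - 1 / real CARD('v)) * M $ z $ y) = M $ x $ y" for x y
  proof -
    have "(\<Sum>z\<in>UNIV. ((if x = z then 1 else 0) - 1 / real CARD('v)) * M $ z $ y)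
        = (\<Sum>z\<in>UNIV. (if x = z then M $ z $ y else 0) - (1 / real CARD('v)) * M $ z $ y)"
      by (intro sum.cong) (auto simp: algebra_simps)
    also have "\<dots> = M $ x $ y - (1 / real CARD('v)) * (\<Sum>z\<in>UNIV. M $ z $ y)"
      by (simp only: sum_subtractf sum_distrib_left) simp
    finally show ?thesis
      using assms by simp
  qed
  then show ?thesis
    by (simp add: matrix_matrix_mult_def vec_eq_iff)
qed

lemma laplacian_column_sum:
  fixes E :: "'v::finite set set"
  assumes "simple_graph E"
  shows "(\<Sum>x\<in>UNIV. laplacian E $ x $ y) = 0"
proof -
  have "(\<Sum>x\<in>UNIV. laplacian E $ x $ y) = (\<Sum>x\<in>UNIV. laplacian E $ y $ x)"
    by (intro sum.cong) (simp_all add: laplacian_def degree_matrix_def adjacency_matrix_def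
        adjacent_def insert_commute)
  \<comment> \<open>A row sum is an entry of the product with the all-ones matrix, whose rows do not differ.\<close>
  also have "\<dots> = (laplacian E ** (\<chi> i j. 1 :: real^'v^'v)) $ y $ y"
    by (simp add: matrix_matrix_mult_def)
  also have "\<dots> = 0"
    by (simp add: laplacian_mult[OF assms])
  finally show ?thesis .
qed

theorem corollary1p2:
  fixes E :: "'v::finite set set" and n :: nat
  assumes "simple_graph E"
    and "connected_graph E"
    and "n = CARD('v)"
  shows "\<forall>u v. green E $ u $ v =
    1 / ((real n)\<^sup>2 * real (card (spanning_trees E))) *
      ((\<Sum>(F, T1, T2) \<in> {(F, T1, T2). (F, T1, T2) \<in> named_2forests E \<and> u \<in> T1 \<and> v \<in> T1}.
          (real (card T2))\<^sup>2)
     - (\<Sum>(F, T1, T2) \<in> {(F, T1, T2). (F, T1, T2) \<in> named_2forests E \<and> u \<in> T1 \<and> v \<in> T2}.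
          real (card T1) * real (card T2)))"
proof -
  note E = assms(1)
  let ?K = "\<lambda>u v. \<Sum>F\<in>spanning_2forests E. forest_kernel F u v"
  define t where "t = real (card (spanning_trees E))"
  define c where "c = 1 / ((real n)\<^sup>2 * t)"
  define X :: "real^'v^'v" where "X = (\<chi> u v. c * ?K u v)"
  define P :: "real^'v^'v" where "P = (\<chi> x y. (if x = y then 1 else 0) - 1 / real CARD('v))"
  have F2: "card (components_of_graph F) = 2" if "F \<in> spanning_2forests E" for F
    using that by (simp add: spanning_2forests_def)
  have t: "t > 0"
    using spanning_tree_exists[OF E assms(2)] by (simp add: t_def card_gt_0_iff)
  have n: "real n > 0"
    using assms(3) by simp
  have "(laplacian E ** X) $ x $ y = P $ x $ y" for x y
  proof -
    let ?h = "\<lambda>C. (if y \<in> C then real n else 0) - real (card C)"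
    have "(laplacian E ** X) $ x $ y = c * (\<Sum>z | {x, z} \<in> E. ?K x y - ?K z y)"
      by (simp add: laplacian_mult[OF E] X_def sum_distrib_left right_diff_distrib)
    also have "(\<Sum>z | {x, z} \<in> E. ?K x y - ?K z y) =
        (\<Sum>F\<in>spanning_2forests E. \<Sum>z | {x, z} \<in> E. forest_kernel F x y - forest_kernel F z y)"
      by (subst sum.swap) (simp add: sum_subtractf)
    \<comment> \<open>Edges inside the component of \<open>x\<close> contribute nothing.\<close>
    also have "\<dots> = (\<Sum>F\<in>spanning_2forests E. \<Sum>z | {x, z} \<in> E \<and> z \<notin> component_of F x.
        real n * ?h (component_of F x))"
      by (intro sum.cong refl sum.mono_neutral_cong_right)
        (auto simp: forest_kernel_diff F2 assms(3))
    also have "\<dots> = (\<Sum>T\<in>spanning_trees E. \<Sum>z | {x, z} \<in> T.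
        real n * ?h (component_of (T - {{x, z}}) x))"
      by (rule sum_forests_eq_sum_trees[OF E])
    also have "\<dots> = (\<Sum>T\<in>spanning_trees E. real n * ((if x = y then real n else 0) - 1))"
      unfolding assms(3)
      by (intro sum.cong refl) (simp only: sum_distrib_left[symmetric] sum_branches_of_tree[OF E])
    also have "c * \<dots> = c * (t * (real n * ((if x = y then real n else 0) - 1)))"
      by (simp add: t_def)
    also have "\<dots> = ((if x = y then real n else 0) - 1) / real n"
      using t n by (simp add: c_def power2_eq_square)
    also have "\<dots> = P $ x $ y"
      using n by (simp add: P_def assms(3)[symmetric] diff_divide_distrib)
    finally show ?thesis .
  qed
  then have LX: "laplacian E ** X = P"
    by (simp add: vec_eq_iff)
  have K_commute: "?K u v = ?K v u" for u v
    by (intro sum.cong refl forest_kernel_commute)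
  have "transpose X = X"
    by (simp add: transpose_def X_def vec_eq_iff K_commute)
  moreover have "transpose P = P"
    by (simp add: transpose_def P_def vec_eq_iff)
  moreover have "P ** laplacian E = laplacian E"
    unfolding P_def by (rule centering_mult) (rule laplacian_column_sum[OF E])
  moreover have "P ** X = X"
    unfolding P_def
  proof (rule centering_mult)
    fix y
    have "(\<Sum>x\<in>UNIV. X $ x $ y) = c * (\<Sum>F\<in>spanning_2forests E. \<Sum>x\<in>UNIV. forest_kernel F y x)"
      by (subst sum.swap) (simp add: X_def sum_distrib_left forest_kernel_commute)
    then show "(\<Sum>x\<in>UNIV. X $ x $ y) = 0"
      using F2 by (simp add: sum_forest_kernel)
  qed
  ultimately have "green E = X"
    unfolding green_def using LX transpose_laplacian by (intro pseudoinverse_symmetricI)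
  then show ?thesis
    by (simp add: X_def c_def t_def sum_named_2forests_eq_forest_kernel)
qed

end
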